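(* Let $n,m,n',m'$ be positive integers with $n+m=n'+m'$, let $\mu,\mu'>0$ be real numbers, and let $f: D_{n,m}(\mu)\to D_{n',m'}(\mu')$ be a biholomorphism. Then $n=n'$, $m=m'$, and there exists $\varphi\in\mathrm{Aut}(D_{n',m'}(\mu'))$ such that $$f(z_1,\dots,z_n,w_1,\dots,w_m)=\varphi\left(\sqrt{\mu/\mu'}\,z_1,\dots,\sqrt{\mu/\mu'}\,z_n,w_1,\dots,w_m\right)$$ for all $(z_1,\dots,z_n,w_1,\dots,w_m)\in D_{n,m}(\mu)$.
   Context: For positive integers $n,m$ and a real number $\mu>0$, the Fock-Bargmann-Hartogs domain is $D_{n,m}(\mu):=\{(z,w)\in\mathbb{C}^n\times\mathbb{C}^m : \|w\|^2<e^{-\mu\|z\|^2}\}$, where $\|\cdot\|$ is the standard Hermitian norm. Two such domains $D_{n,m}(\mu)$ and $D_{n',m'}(\mu')$ are called equidimensional if $n+m=n'+m'$. $\mathrm{Aut}(D)$ denotes the group of biholomorphic self-maps of a domain $D$. *)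

theory Defs
  imports "HOL-Analysis.Analysis"
begin

definition cscale :: "complex \<Rightarrow> (complex^'n) \<times> (complex^'m) \<Rightarrow> (complex^'n) \<times> (complex^'m)"
  where "cscale c x = (c *s fst x, c *s snd x)"

(* The derivative is a priori only real linear; commuting with complex scalars
   makes it complex linear. *)
definition holomorphic_map_on ::
    "((complex^'n) \<times> (complex^'m) \<Rightarrow> (complex^'p) \<times> (complex^'q)) \<Rightarrow> ((complex^'n) \<times> (complex^'m)) set \<Rightarrow> bool"
    (infixl "holomorphic'_map'_on" 50)
  where "f holomorphic_map_on S \<longleftrightarrow>
    (\<forall>x\<in>S. \<exists>f'. (f has_derivative f') (at x within S) \<and> (\<forall>c v. f' (cscale c v) = cscale c (f' v)))"

definition biholomorphism ::
    "((complex^'n) \<times> (complex^'m)) set \<Rightarrow> ((complex^'p) \<times> (complex^'q)) set \<Rightarrow>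
     ((complex^'n) \<times> (complex^'m) \<Rightarrow> (complex^'p) \<times> (complex^'q)) \<Rightarrow> bool"
  where "biholomorphism S T f \<longleftrightarrow>
    bij_betw f S T \<and> f holomorphic_map_on S \<and> inv_into S f holomorphic_map_on T"

(* Automorphisms are total functions; their values outside S are unconstrained. *)
definition Aut :: "((complex^'n) \<times> (complex^'m)) set \<Rightarrow> ((complex^'n) \<times> (complex^'m) \<Rightarrow> (complex^'n) \<times> (complex^'m)) set"
  where "Aut S = {\<phi>. biholomorphism S S \<phi>}"

(* The dimensions are n = CARD('n) and m = CARD('m), both positive. The library norm on
   complex^'n is the standard Hermitian norm. *)
definition FBH_domain :: "real \<Rightarrow> ((complex^'n) \<times> (complex^'m)) set"
  where "FBH_domain \<mu> = {(z, w). (norm w)\<^sup>2 < exp (- \<mu> * (norm z)\<^sup>2)}"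

(* Finite index types carry no canonical enumeration, so coordinates of vectors over different
   index types are matched along bijections \<sigma>, \<tau> of the index types
   (from enumerations e of 'n and e' of 'p one gets \<sigma> = e o inverse of e'). *)
definition scale_relabel ::
    "real \<Rightarrow> ('p \<Rightarrow> 'n) \<Rightarrow> ('q \<Rightarrow> 'm) \<Rightarrow> (complex^'n) \<times> (complex^'m) \<Rightarrow> (complex^'p) \<times> (complex^'q)"
  where "scale_relabel r \<sigma> \<tau> x =
    ((\<chi> i. complex_of_real r * fst x $ \<sigma> i), (\<chi> j. snd x $ \<tau> j))"

end

theory Submission
  imports Defs "HOL-Complex_Analysis.Cauchy_Integral_Formula"
begin

text \<open>
  A Fock-Bargmann-Hartogs domain contains complex lines only inside its zero section
  \<open>{w = 0}\<close>: along an entire curve the bounded component \<open>w\<close> is constant by Liouville's theorem,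
  and if this constant is non-zero, the inequality \<open>\<parallel>w\<parallel>\<^sup>2 < exp (- \<mu> \<parallel>z\<parallel>\<^sup>2)\<close> bounds \<open>z\<close>,
  so the whole curve is constant (\<open>entire_curve_in_zero_section\<close>).

  The zero section itself is a copy of \<open>\<complex>\<^sup>n\<close> and is filled by complex lines. An injective
  holomorphic map between two such domains takes these lines to non-constant entire curves, and
  therefore takes zero section to zero section. Restricted to it, the map is a continuous injection
  of \<open>\<complex>\<^sup>n\<close> into \<open>\<complex>\<^sup>p\<close>, and invariance of dimension gives \<open>n \<le> p\<close>
  (\<open>card_le_if_injective_holomorphic\<close>). For a biholomorphism the inverse map gives \<open>p \<le> n\<close>.

  Once the dimensions agree, the scaling by \<open>sqrt (\<mu> / \<mu>')\<close> is itself a biholomorphism between the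
  domains (\<open>biholomorphism_scale_relabel\<close>), so \<open>\<phi>\<close> is the composition of \<open>f\<close> with its inverse.
\<close>

section \<open>Composition of holomorphic maps\<close>

lemma holomorphic_map_on_compose:
  assumes "f holomorphic_map_on S" "g holomorphic_map_on T" "f ` S \<subseteq> T"
  shows "(g \<circ> f) holomorphic_map_on S"
  unfolding holomorphic_map_on_def
proof
  fix x assume x: "x \<in> S"
  obtain f' where f': "(f has_derivative f') (at x within S)" "\<And>c v. f' (cscale c v) = cscale c (f' v)"
    using assms(1) x unfolding holomorphic_map_on_def by blast
  have "f x \<in> T" using assms(3) x by blast
  then obtain g' where g': "(g has_derivative g') (at (f x) within T)" "\<And>c v. g' (cscale c v) = cscale c (g' v)"
    using assms(2) unfolding holomorphic_map_on_def by blast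
  have "(g \<circ> f has_derivative g' \<circ> f') (at x within S)"
    using diff_chain_within[OF f'(1) has_derivative_subset[OF g'(1) assms(3)]] .
  then show "\<exists>h'. (g \<circ> f has_derivative h') (at x within S) \<and> (\<forall>c v. h' (cscale c v) = cscale c (h' v))"
    using f'(2) g'(2) by (intro exI[of _ "g' \<circ> f'"]) simp
qed

lemma holomorphic_map_on_cong:
  assumes "f holomorphic_map_on S" "\<And>x. x \<in> S \<Longrightarrow> g x = f x"
  shows "g holomorphic_map_on S"
  using assms unfolding holomorphic_map_on_def by (metis has_derivative_transform)

lemma holomorphic_map_on_imp_continuous_on:
  "f holomorphic_map_on S \<Longrightarrow> continuous_on S f"
  unfolding holomorphic_map_on_def continuous_on_eq_continuous_within
  using has_derivative_continuous by blast

lemma biholomorphism_compose: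
  assumes f: "biholomorphism S T f" and g: "biholomorphism T U g"
  shows "biholomorphism S U (g \<circ> f)"
  unfolding biholomorphism_def
proof (intro conjI)
  have bf: "bij_betw f S T" and bg: "bij_betw g T U"
    using f g unfolding biholomorphism_def by auto
  show "bij_betw (g \<circ> f) S U" using bf bg by (rule bij_betw_trans)
  show "(g \<circ> f) holomorphic_map_on S"
    using f g bij_betw_imp_surj_on[OF bf] unfolding biholomorphism_def
    by (intro holomorphic_map_on_compose[where T = T]) auto
  have "(inv_into S f \<circ> inv_into T g) holomorphic_map_on U"
    using f g bij_betw_imp_surj_on[OF bij_betw_inv_into[OF bg]] unfolding biholomorphism_def
    by (intro holomorphic_map_on_compose[where T = T]) auto
  then show "inv_into S (g \<circ> f) holomorphic_map_on U"
    by (rule holomorphic_map_on_cong)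
      (use inv_into_comp[of g f S] bij_betw_imp_surj_on[OF bf] bij_betw_imp_surj_on[OF bg]
          bij_betw_imp_inj_on[OF bf] bij_betw_imp_inj_on[OF bg] in auto)
qed

lemma biholomorphism_inv_into:
  assumes "biholomorphism S T f"
  shows "biholomorphism T S (inv_into S f)"
  unfolding biholomorphism_def
proof (intro conjI)
  have bf: "bij_betw f S T" using assms unfolding biholomorphism_def by auto
  show "bij_betw (inv_into S f) T S" using bf by (rule bij_betw_inv_into)
  show "inv_into S f holomorphic_map_on T" using assms unfolding biholomorphism_def by auto
  have "f holomorphic_map_on S" using assms unfolding biholomorphism_def by auto
  then show "inv_into T (inv_into S f) holomorphic_map_on S"
    by (rule holomorphic_map_on_cong) (rule inv_into_inv_into_eq[OF bf])
qed

text \<open>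
  Complex linearity of the derivative is what turns differentiability along a complex line into
  differentiability in the complex parameter.
\<close>

lemma holomorphic_on_complex_line:
  fixes f :: "(complex^'n) \<times> (complex^'m) \<Rightarrow> (complex^'p) \<times> (complex^'q)"
  assumes f: "f holomorphic_map_on S" and line: "\<And>t. a + cscale t v \<in> S"
  shows "(\<lambda>t. fst (f (a + cscale t v)) $ i) holomorphic_on UNIV"
    and "(\<lambda>t. snd (f (a + cscale t v)) $ j) holomorphic_on UNIV"
proof -
  have lin: "bounded_linear (\<lambda>t. cscale t v)"
    unfolding linear_conv_bounded_linear[symmetric]
    by (rule linearI) (simp_all add: cscale_def prod_eq_iff vec_eq_iff algebra_simps)
  have curve: "((\<lambda>t. a + cscale t v) has_derivative (\<lambda>s. cscale s v)) (at t)" for t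
    using has_derivative_add[OF has_derivative_const bounded_linear_imp_has_derivative[OF lin]]
    by simp
  have "\<exists>d. ((\<lambda>t. f (a + cscale t v)) has_derivative (\<lambda>s. cscale s d)) (at t)" for t
  proof -
    obtain f' where f': "(f has_derivative f') (at (a + cscale t v) within S)"
      "\<And>c u. f' (cscale c u) = cscale c (f' u)"
      using f line[of t] unfolding holomorphic_map_on_def by blast
    have sub: "range (\<lambda>t. a + cscale t v) \<subseteq> S" using line by blast
    have "(f \<circ> (\<lambda>t. a + cscale t v) has_derivative f' \<circ> (\<lambda>s. cscale s v)) (at t)"
      using diff_chain_within[OF curve has_derivative_subset[OF f'(1) sub]] .
    then show ?thesis using f'(2) by (intro exI[of _ "f' v"]) (simp add: o_def)
  qed
  then obtain d where d: "\<And>t. ((\<lambda>t. f (a + cscale t v)) has_derivative (\<lambda>s. cscale s (d t))) (at t)"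
    by metis
  have "((\<lambda>t. fst (f (a + cscale t v)) $ i) has_field_derivative fst (d t) $ i) (at t)" for t
    using bounded_linear.has_derivative[OF bounded_linear_vec_nth has_derivative_fst[OF d]]
    by (rule has_derivative_imp_has_field_derivative) (simp add: cscale_def)
  then show "(\<lambda>t. fst (f (a + cscale t v)) $ i) holomorphic_on UNIV"
    by (auto simp: holomorphic_on_open)
  have "((\<lambda>t. snd (f (a + cscale t v)) $ j) has_field_derivative snd (d t) $ j) (at t)" for t
    using bounded_linear.has_derivative[OF bounded_linear_vec_nth has_derivative_snd[OF d]]
    by (rule has_derivative_imp_has_field_derivative) (simp add: cscale_def)
  then show "(\<lambda>t. snd (f (a + cscale t v)) $ j) holomorphic_on UNIV"
    by (auto simp: holomorphic_on_open)
qed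

section \<open>Entire curves and the zero section\<close>

lemma Liouville_vec:
  fixes h :: "complex \<Rightarrow> complex^'n"
  assumes "\<And>i. (\<lambda>t. h t $ i) holomorphic_on UNIV" and "\<And>t. norm (h t) \<le> B"
  shows "h s = h t"
proof -
  have "h s $ i = h t $ i" for i
  proof -
    have "norm (h t $ i) \<le> B" for t
      using order_trans[OF Finite_Cartesian_Product.norm_nth_le assms(2)] .
    then have bdd: "bounded (range (\<lambda>t. h t $ i))"
      by (intro boundedI[of _ B]) auto
    obtain c where c: "\<And>t. h t $ i = c"
      using Liouville_theorem[of "\<lambda>t. h t $ i", OF assms(1) bdd]
      by (auto simp: constant_on_def)
    show ?thesis by (simp only: c)
  qed
  then show ?thesis by (simp add: vec_eq_iff)
qed

text \<open>
  Both factors are governed by Liouville's theorem: \<open>w\<close> is bounded by 1 everywhere, and the slice of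
  the domain over a fixed \<open>w \<noteq> 0\<close> is a bounded ball in \<open>z\<close>. Only the slice \<open>w = 0\<close> is unbounded.
\<close>

lemma entire_curve_in_zero_section:
  fixes \<gamma> :: "complex \<Rightarrow> (complex^'n) \<times> (complex^'m)"
  assumes "\<mu> > 0" and dom: "\<And>t. \<gamma> t \<in> FBH_domain \<mu>"
    and hol: "\<And>i. (\<lambda>t. fst (\<gamma> t) $ i) holomorphic_on UNIV"
      "\<And>j. (\<lambda>t. snd (\<gamma> t) $ j) holomorphic_on UNIV"
    and nonconst: "\<gamma> a \<noteq> \<gamma> b"
  shows "snd (\<gamma> t) = 0"
proof (rule ccontr)
  assume nz: "snd (\<gamma> t) \<noteq> 0"
  have bound: "(norm (snd (\<gamma> s)))\<^sup>2 < exp (- \<mu> * (norm (fst (\<gamma> s)))\<^sup>2)" for s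
    using dom[of s] by (simp add: FBH_domain_def case_prod_beta)
  have "norm (snd (\<gamma> s)) \<le> 1" for s
  proof -
    have "exp (- \<mu> * (norm (fst (\<gamma> s)))\<^sup>2) \<le> 1" using \<open>\<mu> > 0\<close> by simp
    then have "(norm (snd (\<gamma> s)))\<^sup>2 \<le> 1" using bound[of s] by linarith
    then show ?thesis by (simp add: abs_square_le_1)
  qed
  then have const: "snd (\<gamma> s) = snd (\<gamma> t)" for s
    by (rule Liouville_vec[OF hol(2)])
  define c where "c = ln ((norm (snd (\<gamma> t)))\<^sup>2)"
  have "norm (fst (\<gamma> s)) \<le> sqrt (- c / \<mu>)" for s
  proof -
    have "exp c < exp (- \<mu> * (norm (fst (\<gamma> s)))\<^sup>2)"
      using bound[of s] nz by (simp add: c_def const[of s])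
    then have "(norm (fst (\<gamma> s)))\<^sup>2 \<le> - c / \<mu>"
      using \<open>\<mu> > 0\<close> by (simp add: field_simps)
    then show ?thesis by (rule real_le_rsqrt)
  qed
  then have "fst (\<gamma> a) = fst (\<gamma> b)" by (rule Liouville_vec[OF hol(1)])
  then show False using const[of a] const[of b] nonconst by (simp add: prod_eq_iff)
qed

text \<open>
  Injectivity enters twice: it keeps the images of the complex lines in the zero section non-constant,
  which forces them into the target's zero section, and it makes the resulting map
  \<open>\<complex>\<^sup>n \<rightarrow> \<complex>\<^sup>p\<close> injective, as invariance of dimension demands.
\<close>

lemma card_le_if_injective_holomorphic:
  fixes f :: "(complex^'n) \<times> (complex^'m) \<Rightarrow> (complex^'p) \<times> (complex^'q)"
  assumes "\<mu>' > 0" and inj: "inj_on f (FBH_domain \<mu>)"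
    and into: "f ` FBH_domain \<mu> \<subseteq> FBH_domain \<mu>'" and hol: "f holomorphic_map_on FBH_domain \<mu>"
  shows "CARD('n) \<le> CARD('p)"
proof -
  have zero_section: "(z, 0) \<in> FBH_domain \<mu>" for z :: "complex^'n"
    by (simp add: FBH_domain_def)
  have snd0: "snd (f (z, 0)) = 0" for z :: "complex^'n"
  proof -
    \<comment> \<open>Any complex line through \<open>(z, 0)\<close> inside the zero section serves; \<open>vec 1\<close> is non-zero in every dimension.\<close>
    define \<gamma> where "\<gamma> t = f ((z, 0) + cscale t (vec 1, 0))" for t
    have line: "(z, 0) + cscale t (vec 1, 0) \<in> FBH_domain \<mu>" for t
      by (simp add: cscale_def zero_section)
    have "cscale 0 (vec 1, 0) \<noteq> (cscale 1 (vec 1, 0) :: (complex^'n) \<times> (complex^'m))"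
      by (simp add: cscale_def vec_eq_iff)
    then have "\<gamma> 0 \<noteq> \<gamma> 1"
      using inj_on_eq_iff[OF inj line line, of 0 1] by (simp add: \<gamma>_def)
    moreover have "\<gamma> t \<in> FBH_domain \<mu>'" for t
      using into line unfolding \<gamma>_def by blast
    ultimately have "snd (\<gamma> 0) = 0"
      using holomorphic_on_complex_line[OF hol line, folded \<gamma>_def] \<open>\<mu>' > 0\<close>
      by (intro entire_curve_in_zero_section) auto
    then show ?thesis by (simp add: \<gamma>_def cscale_def)
  qed
  have "continuous_on UNIV (\<lambda>z :: complex^'n. f (z, 0))"
    by (rule continuous_on_compose2[OF holomorphic_map_on_imp_continuous_on[OF hol]])
      (auto intro!: continuous_intros simp: zero_section)
  then have cont: "continuous_on UNIV (\<lambda>z :: complex^'n. fst (f (z, 0)))"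
    by (rule continuous_on_fst)
  have "inj (\<lambda>z :: complex^'n. fst (f (z, 0)))"
  proof (rule injI)
    fix y z :: "complex^'n" assume "fst (f (y, 0)) = fst (f (z, 0))"
    then have "f (y, 0) = f (z, 0)" by (simp add: prod_eq_iff snd0)
    then show "y = z" using inj_on_eq_iff[OF inj zero_section zero_section] by blast
  qed
  from invariance_of_dimension[OF cont open_UNIV this]
  show ?thesis by simp
qed

section \<open>The scaling biholomorphism\<close>

lemma norm_vec_reindex:
  fixes w :: "complex^'m"
  assumes "bij (\<tau> :: 'q::finite \<Rightarrow> 'm)"
  shows "norm (\<chi> j. c * w $ \<tau> j) = norm c * norm w"
proof -
  have "(\<Sum>j\<in>UNIV. (norm (w $ \<tau> j))\<^sup>2) = (\<Sum>i\<in>UNIV. (norm (w $ i))\<^sup>2)"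
    using sum.reindex_bij_betw[OF assms] .
  then show ?thesis
    by (simp add: norm_vec_def L2_set_def norm_mult power_mult_distrib sum_distrib_left[symmetric]
        real_sqrt_mult)
qed

lemma scale_relabel_holomorphic: "scale_relabel r \<sigma> \<tau> holomorphic_map_on S"
proof -
  have "bounded_linear (scale_relabel r \<sigma> \<tau>)"
    unfolding linear_conv_bounded_linear[symmetric]
    by (rule linearI) (simp_all add: scale_relabel_def prod_eq_iff vec_eq_iff algebra_simps)
  then have "(scale_relabel r \<sigma> \<tau> has_derivative scale_relabel r \<sigma> \<tau>) (at x within S)" for x
    by (rule bounded_linear_imp_has_derivative)
  moreover have "scale_relabel r \<sigma> \<tau> (cscale c v) = cscale c (scale_relabel r \<sigma> \<tau> v)" for c v
    by (simp add: scale_relabel_def cscale_def vec_eq_iff)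
  ultimately show ?thesis unfolding holomorphic_map_on_def by blast
qed

text \<open>
  The condition \<open>\<mu>' * r\<^sup>2 = \<mu>\<close> makes the exponents agree: \<open>\<mu>' \<parallel>r z\<parallel>\<^sup>2 = \<mu> \<parallel>z\<parallel>\<^sup>2\<close>. Relabelling
  coordinates preserves both norms.
\<close>

lemma scale_relabel_mem_FBH_domain:
  fixes \<sigma> :: "'p::finite \<Rightarrow> 'n::finite" and \<tau> :: "'q::finite \<Rightarrow> 'm::finite"
  assumes "bij \<sigma>" "bij \<tau>" "\<mu>' * r\<^sup>2 = \<mu>" "x \<in> FBH_domain \<mu>"
  shows "scale_relabel r \<sigma> \<tau> x \<in> FBH_domain \<mu>'"
  using assms(4) norm_vec_reindex[OF assms(1), of "of_real r" "fst x"]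
    norm_vec_reindex[OF assms(2), of 1 "snd x"]
  by (simp add: FBH_domain_def scale_relabel_def case_prod_beta power_mult_distrib
      assms(3)[symmetric] mult.assoc)

lemma scale_relabel_inverse:
  assumes "\<And>i. \<sigma> (\<sigma>' i) = i" "\<And>j. \<tau> (\<tau>' j) = j" "r' * r = 1"
  shows "scale_relabel r' \<sigma>' \<tau>' (scale_relabel r \<sigma> \<tau> x) = x"
proof -
  have "complex_of_real r' * complex_of_real r = 1"
    using assms(3) by (metis of_real_1 of_real_mult)
  then show ?thesis
    by (simp add: scale_relabel_def assms(1,2) prod_eq_iff vec_eq_iff mult.assoc[symmetric])
qed

lemma biholomorphism_scale_relabel:
  fixes \<sigma> :: "'p::finite \<Rightarrow> 'n::finite" and \<tau> :: "'q::finite \<Rightarrow> 'm::finite"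
  assumes "bij \<sigma>" "bij \<tau>" "\<mu>' * r\<^sup>2 = \<mu>" "r \<noteq> 0"
  shows "biholomorphism (FBH_domain \<mu>) (FBH_domain \<mu>') (scale_relabel r \<sigma> \<tau>)"
proof -
  let ?L = "scale_relabel r \<sigma> \<tau>" and ?M = "scale_relabel (1 / r) (inv \<sigma>) (inv \<tau>)"
  have inv1: "?M (?L x) = x" for x
    using assms by (intro scale_relabel_inverse) (auto simp: bij_is_surj surj_f_inv_f)
  have inv2: "?L (?M y) = y" for y
    using assms by (intro scale_relabel_inverse) (auto simp: bij_is_inj inv_f_f)
  have L: "?L x \<in> FBH_domain \<mu>'" if "x \<in> FBH_domain \<mu>" for x
    using scale_relabel_mem_FBH_domain[OF assms(1-3) that] .
  have M: "?M y \<in> FBH_domain \<mu>" if "y \<in> FBH_domain \<mu>'" for y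
    using that assms bij_imp_bij_inv[OF assms(1)] bij_imp_bij_inv[OF assms(2)]
    by (intro scale_relabel_mem_FBH_domain[where \<mu> = \<mu>']) (auto simp: power_divide)
  have bij: "bij_betw ?L (FBH_domain \<mu>) (FBH_domain \<mu>')"
    by (rule bij_betw_byWitness[where f' = ?M]) (auto simp: inv1 inv2 L M)
  have "inv_into (FBH_domain \<mu>) ?L y = ?M y" if "y \<in> FBH_domain \<mu>'" for y
    using inv_into_f_f[OF bij_betw_imp_inj_on[OF bij] M[OF that]] by (simp add: inv2)
  then have "inv_into (FBH_domain \<mu>) ?L holomorphic_map_on FBH_domain \<mu>'"
    by (rule holomorphic_map_on_cong[OF scale_relabel_holomorphic])
  then show ?thesis
    using bij scale_relabel_holomorphic unfolding biholomorphism_def by blast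
qed

section \<open>Classification\<close>

theorem theorem1p2:
  fixes \<mu> \<mu>' :: real
    and f :: "(complex^'n) \<times> (complex^'m) \<Rightarrow> (complex^'p) \<times> (complex^'q)"
  assumes "CARD('n) + CARD('m) = CARD('p) + CARD('q)"
    and "\<mu> > 0" and "\<mu>' > 0"
    and "biholomorphism (FBH_domain \<mu>) (FBH_domain \<mu>') f"
  shows "CARD('n) = CARD('p) \<and> CARD('m) = CARD('q) \<and>
    (\<forall>(\<sigma> :: 'p \<Rightarrow> 'n) (\<tau> :: 'q \<Rightarrow> 'm). bij \<sigma> \<longrightarrow> bij \<tau> \<longrightarrow>
      (\<exists>\<phi> \<in> Aut (FBH_domain \<mu>'). \<forall>x \<in> FBH_domain \<mu>.
        f x = \<phi> (scale_relabel (sqrt (\<mu> / \<mu>')) \<sigma> \<tau> x)))"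
proof -
  have "CARD('n) = CARD('p)"
    using card_le_if_injective_holomorphic[of \<mu>' f \<mu>]
      card_le_if_injective_holomorphic[of \<mu> "inv_into (FBH_domain \<mu>) f" \<mu>']
      assms(2-4) biholomorphism_inv_into[OF assms(4)]
    unfolding biholomorphism_def bij_betw_def by (auto intro!: antisym)
  moreover have "\<exists>\<phi> \<in> Aut (FBH_domain \<mu>'). \<forall>x \<in> FBH_domain \<mu>.
      f x = \<phi> (scale_relabel (sqrt (\<mu> / \<mu>')) \<sigma> \<tau> x)"
    if "bij \<sigma>" "bij \<tau>" for \<sigma> :: "'p \<Rightarrow> 'n" and \<tau> :: "'q \<Rightarrow> 'm"
  proof -
    let ?L = "scale_relabel (sqrt (\<mu> / \<mu>')) \<sigma> \<tau>"
    have L: "biholomorphism (FBH_domain \<mu>) (FBH_domain \<mu>') ?L"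
      using that assms(2,3) by (intro biholomorphism_scale_relabel) auto
    let ?\<phi> = "f \<circ> inv_into (FBH_domain \<mu>) ?L"
    have "?\<phi> \<in> Aut (FBH_domain \<mu>')"
      unfolding Aut_def using biholomorphism_compose[OF biholomorphism_inv_into[OF L] assms(4)] by simp
    moreover have "f x = ?\<phi> (?L x)" if "x \<in> FBH_domain \<mu>" for x
    proof -
      have "bij_betw ?L (FBH_domain \<mu>) (FBH_domain \<mu>')"
        using L unfolding biholomorphism_def by blast
      from bij_betw_inv_into_left[OF this that] show ?thesis by simp
    qed
    ultimately show ?thesis by blast
  qed
  ultimately show ?thesis using assms(1) by auto
qed

end
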